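(* Let $I$ and $J$ be arbitrary (possibly infinite) index sets, and let $M=\prod_{i\in I}M_i$ and $N=\prod_{j\in J}N_j$, where all $M_i$ and $N_j$ are nontrivial monoids with zero satisfying $\mathrm{CCE}(M_i)=\{0,1\}$ and $\mathrm{CCE}(N_j)=\{0,1\}$ for all $i\in I$, $j\in J$. Then every monoid isomorphism $\Phi:M\to N$ is monomial. More precisely, for every monoid isomorphism $\Phi:M\to N$ there exist a unique bijection $\sigma:I\to J$ and unique monoid isomorphisms $\phi_i:M_i\to N_{\sigma(i)}$ ($i\in I$) such that $$\Phi\circ\iota_i=\iota'_{\sigma(i)}\circ\phi_i\qquad\text{and}\qquad \pi'_{\sigma(i)}\circ\Phi=\phi_i\circ\pi_i$$ for every $i\in I$.
   Context: A monoid with zero is a monoid with an absorbing element $0$ ($0x=x0=0$ for all $x$); it is nontrivial if it has more than one element (equivalently $0\neq 1$). For a monoid $M$, $\mathrm{CE}(M)=\{e\in M: e^2=e,\ ex=xe\ \text{for all }x\in M\}$ is the set of central idempotents, partially ordered by $e\le f\iff ef=e$. If $M$ has a zero, $e\in\mathrm{CE}(M)$ is complemented if there is $f\in\mathrm{CE}(M)$ such that $ef=0$ and $1$ is the unique common upper bound of $e$ and $f$ in $\mathrm{CE}(M)$; $\mathrm{CCE}(M)$ denotes the set of complemented central idempotents. Products of monoids have coordinatewise multiplication. $\iota_i:M_i\to M$ is the embedding sending $x$ to the tuple with $i$-th coordinate $x$ and all other coordinates $1$, and $\pi_i:M\to M_i$ is the $i$-th projection; $\iota'_j:N_j\to N$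 and $\pi'_j:N\to N_j$ are the analogous maps for $N$. An isomorphism $\Phi:M\to N$ is monomial if there exist a bijection $\sigma:I\to J$ and isomorphisms $\phi_i:M_i\to N_{\sigma(i)}$ such that $\Phi\circ\iota_i=\iota'_{\sigma(i)}\circ\phi_i$ and $\pi'_{\sigma(i)}\circ\Phi=\phi_i\circ\pi_i$ for every $i\in I$. *)

theory Defs
  imports "HOL-Algebra.Product_Groups"
begin

definition is_absorbing :: "('a, 'm) monoid_scheme \<Rightarrow> 'a \<Rightarrow> bool" where
  "is_absorbing M z \<longleftrightarrow>
     z \<in> carrier M \<and> (\<forall>x\<in>carrier M. z \<otimes>\<^bsub>M\<^esub> x = z \<and> x \<otimes>\<^bsub>M\<^esub> z = z)"

locale monoid_with_zero = monoid +
  assumes ex_absorbing: "\<exists>z. is_absorbing G z"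

text \<open>
  HOL-Algebra's monoid record has no zero field; an absorbing element is unique when it
  exists, so it is recovered by a definite description.
\<close>

definition mzero :: "('a, 'm) monoid_scheme \<Rightarrow> 'a" where
  "mzero M = (THE z. is_absorbing M z)"

lemma absorbing_unique: "is_absorbing M z \<Longrightarrow> is_absorbing M z' \<Longrightarrow> z = z'"
  unfolding is_absorbing_def by metis

lemma (in monoid_with_zero) mzero_absorbing: "is_absorbing G (mzero G)"
  using ex_absorbing absorbing_unique unfolding mzero_def by (metis theI)

definition nontrivial_monoid :: "('a, 'm) monoid_scheme \<Rightarrow> bool" where
  "nontrivial_monoid M \<longleftrightarrow> (\<exists>x\<in>carrier M. \<exists>y\<in>carrier M. x \<noteq> y)"

definition CE :: "('a, 'm) monoid_scheme \<Rightarrow> 'a set" where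
  "CE M = {e \<in> carrier M. e \<otimes>\<^bsub>M\<^esub> e = e \<and> (\<forall>x\<in>carrier M. e \<otimes>\<^bsub>M\<^esub> x = x \<otimes>\<^bsub>M\<^esub> e)}"

definition CE_le :: "('a, 'm) monoid_scheme \<Rightarrow> 'a \<Rightarrow> 'a \<Rightarrow> bool" where
  "CE_le M e f \<longleftrightarrow> e \<otimes>\<^bsub>M\<^esub> f = e"

definition complemented :: "('a, 'm) monoid_scheme \<Rightarrow> 'a \<Rightarrow> bool" where
  "complemented M e \<longleftrightarrow>
     (\<exists>f\<in>CE M. e \<otimes>\<^bsub>M\<^esub> f = mzero M \<and> {g \<in> CE M. CE_le M e g \<and> CE_le M f g} = {\<one>\<^bsub>M\<^esub>})"

definition CCE :: "('a, 'm) monoid_scheme \<Rightarrow> 'a set" where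
  "CCE M = {e \<in> CE M. complemented M e}"

text \<open>
  Despite its name, \<^const>\<open>product_group\<close> is the full direct product of a family of arbitrary
  monoids: its elements are the extensional functions in \<open>\<Pi>\<^sub>E i\<in>I. carrier (M i)\<close>.
\<close>

lemma monoid_product_group:
  assumes "\<And>i. i \<in> I \<Longrightarrow> monoid (M i)"
  shows "monoid (product_group I M)"
proof (rule monoidI)
  fix x assume x: "x \<in> carrier (product_group I M)"
  have eq: "restrict x I = x" using x by (auto simp: PiE_iff extensional_restrict)
  have "(\<lambda>i\<in>I. (\<lambda>i\<in>I. \<one>\<^bsub>M i\<^esub>) i \<otimes>\<^bsub>M i\<^esub> x i) = restrict x I"
    using x by (intro restrict_ext) (auto simp: PiE_iff assms monoid.l_one)
  then show "\<one>\<^bsub>product_group I M\<^esub> \<otimes>\<^bsub>product_group I M\<^esub> x = x" by (simp add: eq)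
  have "(\<lambda>i\<in>I. x i \<otimes>\<^bsub>M i\<^esub> (\<lambda>i\<in>I. \<one>\<^bsub>M i\<^esub>) i) = restrict x I"
    using x by (intro restrict_ext) (auto simp: PiE_iff assms monoid.r_one)
  then show "x \<otimes>\<^bsub>product_group I M\<^esub> \<one>\<^bsub>product_group I M\<^esub> = x" by (simp add: eq)
qed (auto simp: PiE_iff assms monoid.m_closed monoid.m_assoc monoid.one_closed intro!: restrict_ext)

definition prod_embed :: "'i set \<Rightarrow> ('i \<Rightarrow> ('a, 'm) monoid_scheme) \<Rightarrow> 'i \<Rightarrow> 'a \<Rightarrow> 'i \<Rightarrow> 'a" where
  "prod_embed I M i x = (\<lambda>k\<in>I. if k = i then x else \<one>\<^bsub>M k\<^esub>)"

definition prod_proj :: "'i \<Rightarrow> ('i \<Rightarrow> 'a) \<Rightarrow> 'a" where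
  "prod_proj i f = f i"

text \<open>
  \<^const>\<open>iso\<close> only asks for a multiplicative bijection; preservation of \<open>\<one>\<close> is automatic, so
  its elements are exactly the monoid isomorphisms.
\<close>

lemma monoid_iso_one:
  assumes "monoid M" "monoid N" "h \<in> iso M N"
  shows "h \<one>\<^bsub>M\<^esub> = \<one>\<^bsub>N\<^esub>"
proof -
  interpret M: monoid M by fact
  interpret N: monoid N by fact
  have hom: "h \<in> hom M N" and img: "h ` carrier M = carrier N"
    using assms(3) by (auto simp: iso_iff)
  obtain u where u: "u \<in> carrier M" "h u = \<one>\<^bsub>N\<^esub>" using img N.one_closed by (metis imageE)
  have "h \<one>\<^bsub>M\<^esub> \<in> carrier N" using hom by (simp add: hom_in_carrier)
  then have "h \<one>\<^bsub>M\<^esub> = h \<one>\<^bsub>M\<^esub> \<otimes>\<^bsub>N\<^esub> h u" using u(2) by simp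
  also have "\<dots> = h (\<one>\<^bsub>M\<^esub> \<otimes>\<^bsub>M\<^esub> u)" by (simp add: hom_mult[OF hom M.one_closed u(1)])
  finally show ?thesis using u by simp
qed

definition monomial_via ::
  "'i set \<Rightarrow> ('i \<Rightarrow> ('a, 'm) monoid_scheme) \<Rightarrow> 'j set \<Rightarrow> ('j \<Rightarrow> ('b, 'n) monoid_scheme) \<Rightarrow>
   (('i \<Rightarrow> 'a) \<Rightarrow> 'j \<Rightarrow> 'b) \<Rightarrow> ('i \<Rightarrow> 'j) \<Rightarrow> ('i \<Rightarrow> 'a \<Rightarrow> 'b) \<Rightarrow> bool" where
  "monomial_via I M J N \<Phi> \<sigma> \<phi> \<longleftrightarrow>
     bij_betw \<sigma> I J \<and>
     (\<forall>i\<in>I. \<phi> i \<in> iso (M i) (N (\<sigma> i)) \<and>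
        (\<forall>x\<in>carrier (M i). \<Phi> (prod_embed I M i x) = prod_embed J N (\<sigma> i) (\<phi> i x)) \<and>
        (\<forall>f\<in>carrier (product_group I M). prod_proj (\<sigma> i) (\<Phi> f) = \<phi> i (prod_proj i f)))"

definition monomial ::
  "'i set \<Rightarrow> ('i \<Rightarrow> ('a, 'm) monoid_scheme) \<Rightarrow> 'j set \<Rightarrow> ('j \<Rightarrow> ('b, 'n) monoid_scheme) \<Rightarrow>
   (('i \<Rightarrow> 'a) \<Rightarrow> 'j \<Rightarrow> 'b) \<Rightarrow> bool" where
  "monomial I M J N \<Phi> \<longleftrightarrow> (\<exists>\<sigma> \<phi>. monomial_via I M J N \<Phi> \<sigma> \<phi>)"

end

theory Submission
  imports Defs
begin

text \<open>
  The complemented central idempotents of a product of such monoids are the \<open>0\<close>-\<open>1\<close>-valued tuples,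
  and the coatoms among them are the tuples \<open>\<iota>\<^sub>i(0)\<close>. An isomorphism permutes these coatoms, which
  gives \<open>\<sigma>\<close>. The image of \<open>\<iota>\<^sub>i\<close> is \<open>{x. x \<cdot> \<iota>\<^sub>i(0) = \<iota>\<^sub>i(0)}\<close>, so \<open>\<Phi>\<close> maps it onto the image of
  \<open>\<iota>'\<close> at \<open>\<sigma>(i)\<close>; two tuples agree at \<open>i\<close> iff they agree after multiplication by the complement of
  \<open>\<iota>\<^sub>i(0)\<close>, which gives compatibility with the projections.
\<close>

section \<open>Zero elements\<close>

lemma mzero_eqI: "is_absorbing M z \<Longrightarrow> mzero M = z"
  unfolding mzero_def using absorbing_unique by (metis the_equality)

context monoid_with_zero
begin

lemma mzero_closed [simp]: "mzero G \<in> carrier G"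
  using mzero_absorbing by (simp add: is_absorbing_def)

lemma l_mzero [simp]: "x \<in> carrier G \<Longrightarrow> mzero G \<otimes> x = mzero G"
  using mzero_absorbing by (simp add: is_absorbing_def)

lemma r_mzero [simp]: "x \<in> carrier G \<Longrightarrow> x \<otimes> mzero G = mzero G"
  using mzero_absorbing by (simp add: is_absorbing_def)

text \<open>If 0 = 1, then x = 1x = 0x = 0 for every x, so the carrier is a singleton.\<close>

lemma nontrivial_imp_mzero_neq_one:
  assumes "nontrivial_monoid G"
  shows "mzero G \<noteq> \<one>"
  using assms l_mzero l_one unfolding nontrivial_monoid_def by metis

end

section \<open>Central idempotents, complements and coatoms\<close>

lemma CE_closed: "e \<in> CE M \<Longrightarrow> e \<in> carrier M"
  by (simp add: CE_def)

lemma CE_idem: "e \<in> CE M \<Longrightarrow> e \<otimes>\<^bsub>M\<^esub> e = e"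
  by (simp add: CE_def)

lemma CE_comm: "e \<in> CE M \<Longrightarrow> x \<in> carrier M \<Longrightarrow> e \<otimes>\<^bsub>M\<^esub> x = x \<otimes>\<^bsub>M\<^esub> e"
  unfolding CE_def by blast

lemma CE_I:
  assumes "e \<in> carrier M" "e \<otimes>\<^bsub>M\<^esub> e = e" "\<And>x. x \<in> carrier M \<Longrightarrow> e \<otimes>\<^bsub>M\<^esub> x = x \<otimes>\<^bsub>M\<^esub> e"
  shows "e \<in> CE M"
  unfolding CE_def using assms by blast

lemma (in monoid) one_in_CE: "\<one> \<in> CE G"
  by (rule CE_I) auto

text \<open>\<open>\<one>\<close> is always a common upper bound, so only its uniqueness has to be
  expressed. What remains consists of equations quantified over \<open>CE G\<close>, a form that is
  easy to transport along an isomorphism.\<close>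

lemma (in monoid) complemented_iff:
  assumes "e \<in> carrier G"
  shows "complemented G e \<longleftrightarrow>
    (\<exists>f\<in>CE G. e \<otimes> f = mzero G \<and> (\<forall>g\<in>CE G. e \<otimes> g = e \<longrightarrow> f \<otimes> g = f \<longrightarrow> g = \<one>))"
proof -
  have "{g \<in> CE G. CE_le G e g \<and> CE_le G f g} = {\<one>} \<longleftrightarrow>
      (\<forall>g\<in>CE G. e \<otimes> g = e \<longrightarrow> f \<otimes> g = f \<longrightarrow> g = \<one>)" if "f \<in> CE G" for f
    using assms CE_closed[OF that] one_in_CE unfolding CE_le_def by (auto simp: set_eq_iff)
  then show ?thesis unfolding complemented_def by blast
qed

lemma CCE_closed: "e \<in> CCE M \<Longrightarrow> e \<in> carrier M"
  by (simp add: CCE_def CE_def)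

text \<open>These are the maximal elements of \<open>CCE M\<close> without \<open>\<one>\<close>.
  The order is written out as an equation between products, so that only multiplication,
  \<open>\<one>\<close> and \<open>CCE\<close> occur.\<close>

definition CCE_coatom :: "('a, 'm) monoid_scheme \<Rightarrow> 'a \<Rightarrow> bool" where
  "CCE_coatom M c \<longleftrightarrow> c \<in> CCE M \<and> c \<noteq> \<one>\<^bsub>M\<^esub> \<and>
     (\<forall>g\<in>CCE M. c \<otimes>\<^bsub>M\<^esub> g = c \<longrightarrow> g = c \<or> g = \<one>\<^bsub>M\<^esub>)"

section \<open>Invariance under an isomorphism\<close>

locale monoid_with_zero_iso =
  M: monoid_with_zero M + N: monoid_with_zero N for M (structure) and N (structure) +
  fixes h
  assumes iso: "h \<in> iso M N"
begin

lemma closed [simp]: "x \<in> carrier M \<Longrightarrow> h x \<in> carrier N"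
  using iso by (auto simp: iso_iff intro: hom_in_carrier)

lemma mult: "x \<in> carrier M \<Longrightarrow> y \<in> carrier M \<Longrightarrow> h (x \<otimes>\<^bsub>M\<^esub> y) = h x \<otimes>\<^bsub>N\<^esub> h y"
  using iso by (auto simp: iso_iff intro: hom_mult)

lemma eq_iff: "x \<in> carrier M \<Longrightarrow> y \<in> carrier M \<Longrightarrow> h x = h y \<longleftrightarrow> x = y"
  using iso by (auto simp: iso_iff inj_on_eq_iff)

lemma surjE:
  assumes "y \<in> carrier N"
  obtains x where "x \<in> carrier M" "y = h x"
  using assms iso by (auto simp: iso_iff)

lemma map_one: "h \<one>\<^bsub>M\<^esub> = \<one>\<^bsub>N\<^esub>"
  using monoid_iso_one M.monoid_axioms N.monoid_axioms iso by blast

text \<open>By surjectivity every element of \<open>N\<close> is some \<open>h x\<close>, and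
  \<open>h (mzero M)\<close> absorbs it because \<open>mzero M\<close> absorbs
  \<open>x\<close>.\<close>

lemma map_mzero: "h (mzero M) = mzero N"
proof (rule mzero_eqI[symmetric])
  show "is_absorbing N (h (mzero M))"
    unfolding is_absorbing_def by (auto elim!: surjE simp flip: mult)
qed

text \<open>Injectivity lets the equations for \<open>h e\<close> be pulled back to
  \<open>e\<close>. Conversely, surjectivity reduces centrality in \<open>N\<close> to commutation
  with images.\<close>

lemma CE_iff:
  assumes e: "e \<in> carrier M"
  shows "h e \<in> CE N \<longleftrightarrow> e \<in> CE M"
proof
  assume he: "h e \<in> CE N"
  show "e \<in> CE M"
  proof (rule CE_I[OF e])
    show "e \<otimes>\<^bsub>M\<^esub> e = e"
      using CE_idem[OF he] mult[OF e e] eq_iff e by (metis M.m_closed)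
    fix x assume x: "x \<in> carrier M"
    show "e \<otimes>\<^bsub>M\<^esub> x = x \<otimes>\<^bsub>M\<^esub> e"
      using CE_comm[OF he closed[OF x]] mult[OF e x] mult[OF x e] eq_iff e x by (metis M.m_closed)
  qed
next
  assume e': "e \<in> CE M"
  show "h e \<in> CE N"
  proof (rule CE_I)
    show "h e \<otimes>\<^bsub>N\<^esub> h e = h e" using CE_idem[OF e'] mult[OF e e] by metis
    fix y assume "y \<in> carrier N"
    then obtain x where x: "x \<in> carrier M" "y = h x" by (rule surjE)
    then show "h e \<otimes>\<^bsub>N\<^esub> y = y \<otimes>\<^bsub>N\<^esub> h e"
      using CE_comm[OF e' x(1)] mult[OF e x(1)] mult[OF x(1) e] by metis
  qed (simp add: e)
qed

lemma CE_image: "CE N = h ` CE M"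
proof (intro equalityI subsetI)
  fix y assume y: "y \<in> CE N"
  then obtain x where "x \<in> carrier M" "y = h x" using CE_closed surjE by metis
  then show "y \<in> h ` CE M" using y CE_iff by auto
qed (auto simp: CE_iff CE_closed)

lemma mult_eq_iff:
  assumes "x \<in> carrier M" "y \<in> carrier M" "z \<in> carrier M"
  shows "h x \<otimes>\<^bsub>N\<^esub> h y = h z \<longleftrightarrow> x \<otimes>\<^bsub>M\<^esub> y = z"
  using assms by (simp add: eq_iff flip: mult)

text \<open>Since \<open>CE N\<close> is the image of \<open>CE M\<close>, the quantifiers on the
  two sides range over corresponding elements, and each equation under them is preserved and
  reflected by \<open>h\<close>.\<close>

lemma complemented_image_iff:
  assumes e: "e \<in> carrier M"
  shows "complemented N (h e) \<longleftrightarrow> complemented M e"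
proof -
  have "h e \<otimes>\<^bsub>N\<^esub> h f = mzero N \<longleftrightarrow> e \<otimes>\<^bsub>M\<^esub> f = mzero M"
    and "h e \<otimes>\<^bsub>N\<^esub> h f = h e \<longleftrightarrow> e \<otimes>\<^bsub>M\<^esub> f = e"
    and "h f = \<one>\<^bsub>N\<^esub> \<longleftrightarrow> f = \<one>\<^bsub>M\<^esub>" if "f \<in> CE M" for f
    using CE_closed[OF that] e by (simp_all add: mult_eq_iff eq_iff flip: map_mzero map_one)
  moreover have "h f \<otimes>\<^bsub>N\<^esub> h g = h f \<longleftrightarrow> f \<otimes>\<^bsub>M\<^esub> g = f" if "f \<in> CE M" "g \<in> CE M" for f g
    using CE_closed[OF that(1)] CE_closed[OF that(2)] by (simp add: mult_eq_iff)
  ultimately show ?thesis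
    unfolding M.complemented_iff[OF e] N.complemented_iff[OF closed[OF e]] CE_image by simp
qed

lemma CCE_iff: "e \<in> carrier M \<Longrightarrow> h e \<in> CCE N \<longleftrightarrow> e \<in> CCE M"
  by (simp add: CCE_def CE_iff complemented_image_iff)

lemma CCE_image: "CCE N = h ` CCE M"
proof (intro equalityI subsetI)
  fix y assume y: "y \<in> CCE N"
  then obtain x where "x \<in> carrier M" "y = h x" using CCE_closed surjE by metis
  then show "y \<in> h ` CCE M" using y CCE_iff by auto
qed (auto simp: CCE_iff CCE_closed)

lemma CCE_coatom_iff:
  assumes c: "c \<in> carrier M"
  shows "CCE_coatom N (h c) \<longleftrightarrow> CCE_coatom M c"
proof -
  have "(h c \<otimes>\<^bsub>N\<^esub> h g = h c \<longrightarrow> h g = h c \<or> h g = \<one>\<^bsub>N\<^esub>) \<longleftrightarrow>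
      (c \<otimes>\<^bsub>M\<^esub> g = c \<longrightarrow> g = c \<or> g = \<one>\<^bsub>M\<^esub>)" if "g \<in> CCE M" for g
    using CCE_closed[OF that] c by (simp add: mult_eq_iff eq_iff flip: map_one)
  moreover have "h c = \<one>\<^bsub>N\<^esub> \<longleftrightarrow> c = \<one>\<^bsub>M\<^esub>" using c by (simp add: eq_iff flip: map_one)
  ultimately show ?thesis
    using CCE_iff[OF c] unfolding CCE_coatom_def CCE_image by simp
qed

end

section \<open>Products of monoids whose only complemented central idempotents are 0 and 1\<close>

locale indecomposable_family =
  fixes I :: "'i set" and M :: "'i \<Rightarrow> ('a, 'm) monoid_scheme"
  assumes with_zero: "i \<in> I \<Longrightarrow> monoid_with_zero (M i)"
    and nontrivial: "i \<in> I \<Longrightarrow> nontrivial_monoid (M i)"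
    and CCE_component: "i \<in> I \<Longrightarrow> CCE (M i) = {mzero (M i), \<one>\<^bsub>M i\<^esub>}"
begin

abbreviation P :: "('i \<Rightarrow> 'a) monoid" where "P \<equiv> product_group I M"

definition coatom :: "'i \<Rightarrow> 'i \<Rightarrow> 'a" where
  "coatom i = prod_embed I M i (mzero (M i))"

text \<open>This is the complement of \<open>coatom i\<close>. Multiplying by it keeps coordinate
  \<open>i\<close> and sends all other coordinates to zero.\<close>

definition atom :: "'i \<Rightarrow> 'i \<Rightarrow> 'a" where
  "atom i = (\<lambda>k\<in>I. if k = i then \<one>\<^bsub>M k\<^esub> else mzero (M k))"

lemma is_monoid: "i \<in> I \<Longrightarrow> monoid (M i)"
  using with_zero monoid_with_zero.axioms(1) by blast

lemmas component_simps [simp] =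
  monoid.l_one[OF is_monoid] monoid.r_one[OF is_monoid]
  monoid.one_closed[OF is_monoid] monoid.m_closed[OF is_monoid]
  monoid_with_zero.mzero_closed[OF with_zero]
  monoid_with_zero.l_mzero[OF with_zero] monoid_with_zero.r_mzero[OF with_zero]
  monoid_with_zero.nontrivial_imp_mzero_neq_one[OF with_zero nontrivial]
  monoid_with_zero.nontrivial_imp_mzero_neq_one[OF with_zero nontrivial, symmetric]

lemma component_closed: "x \<in> carrier P \<Longrightarrow> i \<in> I \<Longrightarrow> x i \<in> carrier (M i)"
  by (auto simp: PiE_iff)

text \<open>Elements of the product are extensional functions, so outside \<open>I\<close> both
  sides are \<open>undefined\<close>.\<close>

lemma P_ext:
  assumes "x \<in> carrier P" "y \<in> carrier P" "\<And>i. i \<in> I \<Longrightarrow> x i = y i"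
  shows "x = y"
  using assms by (auto intro: PiE_ext)

lemma P_closed_mult: "x \<in> carrier P \<Longrightarrow> y \<in> carrier P \<Longrightarrow> x \<otimes>\<^bsub>P\<^esub> y \<in> carrier P"
  by (rule monoid.m_closed[OF monoid_product_group[OF is_monoid]])

lemma P_mult_apply [simp]: "i \<in> I \<Longrightarrow> (x \<otimes>\<^bsub>P\<^esub> y) i = x i \<otimes>\<^bsub>M i\<^esub> y i"
  by simp

declare carrier_product_group [simp del] mult_product_group [simp del]

lemma P_one_closed: "\<one>\<^bsub>P\<^esub> \<in> carrier P"
  by (rule monoid.one_closed[OF monoid_product_group[OF is_monoid]])

lemma P_mult_eq_iff:
  assumes "x \<in> carrier P" "y \<in> carrier P" "z \<in> carrier P"
  shows "x \<otimes>\<^bsub>P\<^esub> y = z \<longleftrightarrow> (\<forall>i\<in>I. x i \<otimes>\<^bsub>M i\<^esub> y i = z i)"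
  using assms P_ext[of "x \<otimes>\<^bsub>P\<^esub> y" z] P_closed_mult P_mult_apply by metis

lemma absorbing_P: "is_absorbing P (\<lambda>i\<in>I. mzero (M i))"
proof -
  have z: "(\<lambda>i\<in>I. mzero (M i)) \<in> carrier P" by (auto simp: carrier_product_group)
  show ?thesis
    unfolding is_absorbing_def using z by (auto simp: P_mult_eq_iff component_closed)
qed

sublocale P: monoid_with_zero P
  using monoid_product_group[OF is_monoid] absorbing_P
  by (auto simp: monoid_with_zero_def monoid_with_zero_axioms_def)

lemma mzero_P: "mzero P = (\<lambda>i\<in>I. mzero (M i))"
  using absorbing_P by (rule mzero_eqI)

text \<open>This supplies test tuples: changing \<open>\<one>\<close> in a single coordinate turns a
  statement about the product into one about that component.\<close>

lemma P_upd_closed: "x \<in> carrier P \<Longrightarrow> i \<in> I \<Longrightarrow> a \<in> carrier (M i) \<Longrightarrow> x(i := a) \<in> carrier P"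
  by (auto simp: carrier_product_group PiE_iff extensional_def)

section \<open>Central idempotents of the product, coordinate by coordinate\<close>

lemma CE_P_iff: "e \<in> CE P \<longleftrightarrow> e \<in> carrier P \<and> (\<forall>i\<in>I. e i \<in> CE (M i))"
proof (intro iffI conjI ballI)
  assume e: "e \<in> CE P"
  then show ec: "e \<in> carrier P" by (rule CE_closed)
  fix i assume i: "i \<in> I"
  have "e i \<otimes>\<^bsub>M i\<^esub> a = a \<otimes>\<^bsub>M i\<^esub> e i" if a: "a \<in> carrier (M i)" for a
  proof -
    \<comment> \<open>Commutation with the tuple that is \<open>a\<close> at \<open>i\<close> and 1
      elsewhere gives commutation of \<open>e i\<close> with \<open>a\<close>.\<close>
    have "e \<otimes>\<^bsub>P\<^esub> (\<one>\<^bsub>P\<^esub>(i := a)) = (\<one>\<^bsub>P\<^esub>(i := a)) \<otimes>\<^bsub>P\<^esub> e"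
      by (rule CE_comm[OF e P_upd_closed[OF P_one_closed i a]])
    from fun_cong[OF this, of i] show ?thesis using i by simp
  qed
  moreover have "e i \<otimes>\<^bsub>M i\<^esub> e i = e i"
    using CE_idem[OF e] ec i P_mult_eq_iff[of e e e] by blast
  ultimately show "e i \<in> CE (M i)" using component_closed[OF ec i] by (intro CE_I) blast+
next
  assume e: "e \<in> carrier P \<and> (\<forall>i\<in>I. e i \<in> CE (M i))"
  have "e \<otimes>\<^bsub>P\<^esub> x = x \<otimes>\<^bsub>P\<^esub> e" if x: "x \<in> carrier P" for x
  proof (rule P_ext)
    fix i assume i: "i \<in> I"
    then have "e i \<otimes>\<^bsub>M i\<^esub> x i = x i \<otimes>\<^bsub>M i\<^esub> e i"
      using e CE_comm component_closed[OF x i] by metis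
    then show "(e \<otimes>\<^bsub>P\<^esub> x) i = (x \<otimes>\<^bsub>P\<^esub> e) i" using i by (simp add: P_mult_apply)
  qed (use e x P_closed_mult in blast)+
  moreover have "e \<otimes>\<^bsub>P\<^esub> e = e" using e by (subst P_mult_eq_iff) (auto simp: CE_idem)
  ultimately show "e \<in> CE P" using e by (intro CE_I) blast+
qed

lemma CE_component: "i \<in> I \<Longrightarrow> mzero (M i) \<in> CE (M i)" "i \<in> I \<Longrightarrow> \<one>\<^bsub>M i\<^esub> \<in> CE (M i)"
  using CCE_component[of i] unfolding CCE_def by blast+

text \<open>The coordinate \<open>f i\<close> of a complement \<open>f\<close> of \<open>e\<close>
  is a complement of \<open>e i\<close>, so the hypothesis on the components forces
  \<open>e i\<close> to be 0 or 1. Conversely, exchanging 0 and 1 in a 0-1 tuple gives a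
  complement.\<close>

lemma CCE_P_iff:
  "e \<in> CCE P \<longleftrightarrow> e \<in> carrier P \<and> (\<forall>i\<in>I. e i = mzero (M i) \<or> e i = \<one>\<^bsub>M i\<^esub>)"
proof (intro iffI conjI ballI)
  assume e: "e \<in> CCE P"
  then show ec: "e \<in> carrier P" by (rule CCE_closed)
  have eCE: "e \<in> CE P" using e by (simp add: CCE_def)
  from e obtain f where f: "f \<in> CE P" "e \<otimes>\<^bsub>P\<^esub> f = mzero P"
    and ub: "\<And>g. g \<in> CE P \<Longrightarrow> e \<otimes>\<^bsub>P\<^esub> g = e \<Longrightarrow> f \<otimes>\<^bsub>P\<^esub> g = f \<Longrightarrow> g = \<one>\<^bsub>P\<^esub>"
    unfolding CCE_def using P.complemented_iff[OF ec] by blast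
  have fc: "f \<in> carrier P" using f(1) by (rule CE_closed)
  fix i assume i: "i \<in> I"
  have "a = \<one>\<^bsub>M i\<^esub>"
    if a: "a \<in> CE (M i)" "e i \<otimes>\<^bsub>M i\<^esub> a = e i" "f i \<otimes>\<^bsub>M i\<^esub> a = f i" for a
  proof -
    \<comment> \<open>A common upper bound \<open>a\<close> of \<open>e i\<close> and
      \<open>f i\<close>, filled up with 1 elsewhere, is a common upper bound of \<open>e\<close>
      and \<open>f\<close>, hence trivial.\<close>
    let ?g = "\<one>\<^bsub>P\<^esub>(i := a)"
    have gc: "?g \<in> carrier P" by (rule P_upd_closed[OF P_one_closed i CE_closed[OF a(1)]])
    have "?g \<in> CE P"
      using gc a(1) CE_component(2) by (auto simp: CE_P_iff)
    moreover have "e \<otimes>\<^bsub>P\<^esub> ?g = e" "f \<otimes>\<^bsub>P\<^esub> ?g = f"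
      unfolding P_mult_eq_iff[OF ec gc ec] P_mult_eq_iff[OF fc gc fc]
      using a component_closed[OF ec] component_closed[OF fc] by auto
    ultimately have "?g = \<one>\<^bsub>P\<^esub>" by (rule ub)
    from fun_cong[OF this, of i] show ?thesis using i by simp
  qed
  moreover have "e i \<otimes>\<^bsub>M i\<^esub> f i = mzero (M i)"
    using fun_cong[OF f(2), of i] i by (simp add: mzero_P)
  moreover have "e i \<in> CE (M i)" "f i \<in> CE (M i)"
    using f(1) eCE i CE_P_iff by blast+
  ultimately have "e i \<in> CCE (M i)"
    unfolding CCE_def using monoid.complemented_iff[OF is_monoid[OF i] component_closed[OF ec i]]
    by blast
  then show "e i = mzero (M i) \<or> e i = \<one>\<^bsub>M i\<^esub>" using CCE_component i by blast
next
  assume *: "e \<in> carrier P \<and> (\<forall>i\<in>I. e i = mzero (M i) \<or> e i = \<one>\<^bsub>M i\<^esub>)"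
  then have ec: "e \<in> carrier P" by blast
  \<comment> \<open>The candidate complement exchanges 0 and 1 in every coordinate.\<close>
  define f where "f = (\<lambda>i\<in>I. if e i = \<one>\<^bsub>M i\<^esub> then mzero (M i) else \<one>\<^bsub>M i\<^esub>)"
  have fc: "f \<in> carrier P" by (auto simp: carrier_product_group f_def)
  have e: "e \<in> CE P" unfolding CE_P_iff using * CE_component by metis
  have f: "f \<in> CE P" unfolding CE_P_iff using fc CE_component by (simp add: f_def)
  have "e \<otimes>\<^bsub>P\<^esub> f = mzero P"
    unfolding P_mult_eq_iff[OF ec fc P.mzero_closed] using * by (auto simp: f_def mzero_P)
  moreover have "g = \<one>\<^bsub>P\<^esub>" if g: "g \<in> CE P" "e \<otimes>\<^bsub>P\<^esub> g = e" "f \<otimes>\<^bsub>P\<^esub> g = f" for g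
  proof (rule P_ext)
    show gc: "g \<in> carrier P" using g(1) by (rule CE_closed)
    fix i assume i: "i \<in> I"
    then have "e i \<otimes>\<^bsub>M i\<^esub> g i = e i" "f i \<otimes>\<^bsub>M i\<^esub> g i = f i"
      using g(2,3) P_mult_apply[OF i] by metis+
    \<comment> \<open>One of \<open>e i\<close> and \<open>f i\<close> is 1, and the corresponding
      equation then reads \<open>g i\<close> = 1.\<close>
    then show "g i = \<one>\<^bsub>P\<^esub> i"
      using i component_closed[OF gc i] * by (auto simp: f_def split: if_splits)
  qed (rule P_one_closed)
  ultimately have "complemented P e" unfolding P.complemented_iff[OF ec] using f by blast
  then show "e \<in> CCE P" using e by (simp add: CCE_def)
qed

section \<open>Embeddings, coatoms and atoms of the product\<close>

lemma prod_embed_closed: "i \<in> I \<Longrightarrow> a \<in> carrier (M i) \<Longrightarrow> prod_embed I M i a \<in> carrier P"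
  by (auto simp: carrier_product_group prod_embed_def)

lemma prod_embed_apply:
  "k \<in> I \<Longrightarrow> prod_embed I M i a k = (if k = i then a else \<one>\<^bsub>M k\<^esub>)"
  by (simp add: prod_embed_def)

lemma prod_embed_inj: "i \<in> I \<Longrightarrow> prod_embed I M i a = prod_embed I M i b \<Longrightarrow> a = b"
  by (metis prod_embed_apply)

lemma prod_embed_mult:
  assumes "i \<in> I" "a \<in> carrier (M i)" "b \<in> carrier (M i)"
  shows "prod_embed I M i (a \<otimes>\<^bsub>M i\<^esub> b) = prod_embed I M i a \<otimes>\<^bsub>P\<^esub> prod_embed I M i b"
  by (rule ext) (simp add: prod_embed_def mult_product_group)

lemma coatom_apply: "k \<in> I \<Longrightarrow> coatom i k = (if k = i then mzero (M k) else \<one>\<^bsub>M k\<^esub>)"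
  by (simp add: coatom_def prod_embed_apply)

lemma coatom_closed: "i \<in> I \<Longrightarrow> coatom i \<in> carrier P"
  by (simp add: coatom_def prod_embed_closed)

lemma atom_apply: "k \<in> I \<Longrightarrow> atom i k = (if k = i then \<one>\<^bsub>M k\<^esub> else mzero (M k))"
  by (simp add: atom_def)

lemma atom_closed: "atom i \<in> carrier P"
  by (auto simp: carrier_product_group atom_def)

text \<open>For distinct indices the tuples have 0 and 1 at coordinate \<open>i\<close>; these
  differ by nontriviality, which is \<open>component_simps(8)\<close>.\<close>

lemma coatom_eq_iff: "i \<in> I \<Longrightarrow> k \<in> I \<Longrightarrow> coatom i = coatom k \<longleftrightarrow> i = k"
  by (metis coatom_apply component_simps(8))

text \<open>Recording where a 0-1 tuple equals 1 identifies \<open>CCE P\<close> with the power set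
  of \<open>I\<close>, ordered by inclusion. Its coatoms are the complements of singletons.\<close>

lemma CCE_coatom_P_iff: "CCE_coatom P c \<longleftrightarrow> (\<exists>i\<in>I. c = coatom i)"
proof
  assume c: "CCE_coatom P c"
  then have cc: "c \<in> carrier P" and c01: "\<forall>i\<in>I. c i = mzero (M i) \<or> c i = \<one>\<^bsub>M i\<^esub>"
    and max: "\<And>g. g \<in> CCE P \<Longrightarrow> c \<otimes>\<^bsub>P\<^esub> g = c \<Longrightarrow> g = c \<or> g = \<one>\<^bsub>P\<^esub>"
    unfolding CCE_coatom_def by (auto simp only: CCE_P_iff)
  have "\<exists>i\<in>I. c i \<noteq> \<one>\<^bsub>M i\<^esub>"
    using c P_ext[OF cc P_one_closed] unfolding CCE_coatom_def by auto
  then obtain i where i: "i \<in> I" "c i = mzero (M i)" using c01 by blast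
  have "coatom i \<in> CCE P"
    using coatom_closed[OF i(1)] by (auto simp: CCE_P_iff coatom_apply)
  moreover have "c \<otimes>\<^bsub>P\<^esub> coatom i = c"
    using i cc coatom_closed[OF i(1)]
    by (auto simp: P_mult_eq_iff coatom_apply component_closed)
  moreover have "coatom i \<noteq> \<one>\<^bsub>P\<^esub>"
    using i by (auto dest!: fun_cong[of _ _ i] simp: coatom_apply)
  ultimately show "\<exists>i\<in>I. c = coatom i" using max i(1) by blast
next
  assume "\<exists>i\<in>I. c = coatom i"
  then obtain i where i: "i \<in> I" and c: "c = coatom i" by blast
  have cc: "c \<in> carrier P" using c i coatom_closed by blast
  have "c \<in> CCE P" using cc by (auto simp: CCE_P_iff c coatom_apply)
  moreover have "c \<noteq> \<one>\<^bsub>P\<^esub>"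
    using i by (auto dest!: fun_cong[of _ _ i] simp: c coatom_apply)
  moreover have "g = c \<or> g = \<one>\<^bsub>P\<^esub>" if g: "g \<in> CCE P" and le: "c \<otimes>\<^bsub>P\<^esub> g = c" for g
  proof -
    have gc: "g \<in> carrier P" using g by (rule CCE_closed)
    \<comment> \<open>Off \<open>i\<close> the tuple \<open>c\<close> is 1, so \<open>c\<close>
      below \<open>g\<close> forces \<open>g k\<close> = 1 there; only coordinate \<open>i\<close>
      is still free.\<close>
    have gk: "g k = \<one>\<^bsub>M k\<^esub>" if "k \<in> I" "k \<noteq> i" for k
      using fun_cong[OF le, of k] that component_closed[OF gc] by (simp add: c coatom_apply)
    have "g i = mzero (M i) \<or> g i = \<one>\<^bsub>M i\<^esub>" using g i CCE_P_iff by blast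
    then show ?thesis
    proof
      assume "g i = mzero (M i)"
      then have "g = c" using gk by (intro P_ext[OF gc cc]) (simp add: c coatom_apply)
      then show ?thesis ..
    next
      assume "g i = \<one>\<^bsub>M i\<^esub>"
      then have "g = \<one>\<^bsub>P\<^esub>" using gk by (intro P_ext[OF gc P_one_closed]) (metis one_product_group restrict_apply')
      then show ?thesis ..
    qed
  qed
  ultimately show "CCE_coatom P c" unfolding CCE_coatom_def by blast
qed

text \<open>In terms of subsets of \<open>I\<close>, the only nonempty set disjoint from the
  complement of {i} is {i} itself. This form mentions only notions that an isomorphism preserves, so
  atoms can be followed once coatoms are.\<close>

lemma atom_iff:
  assumes i: "i \<in> I"
  shows "f = atom i \<longleftrightarrow> f \<in> CCE P \<and> f \<noteq> mzero P \<and> coatom i \<otimes>\<^bsub>P\<^esub> f = mzero P"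
proof (intro iffI conjI)
  assume f: "f \<in> CCE P \<and> f \<noteq> mzero P \<and> coatom i \<otimes>\<^bsub>P\<^esub> f = mzero P"
  then have fc: "f \<in> carrier P" by (intro CCE_closed) blast
  have fk: "f k = mzero (M k)" if "k \<in> I" "k \<noteq> i" for k
    using f that component_closed[OF fc]
    by (auto dest!: fun_cong[of _ _ k] simp: coatom_apply mzero_P)
  have "f i \<noteq> mzero (M i)"
    using f fk P_ext[OF fc P.mzero_closed] by (metis mzero_P restrict_apply')
  then have "f i = \<one>\<^bsub>M i\<^esub>" using f i CCE_P_iff by blast
  then show "f = atom i" using fk by (intro P_ext[OF fc atom_closed]) (simp add: atom_apply)
next
  assume f: "f = atom i"
  show "f \<in> CCE P"
    using f atom_closed by (auto simp: CCE_P_iff atom_apply)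
  show "f \<noteq> mzero P"
    using f i by (auto dest!: fun_cong[of _ _ i] simp: atom_apply mzero_P)
  show "coatom i \<otimes>\<^bsub>P\<^esub> f = mzero P"
    using f atom_closed coatom_closed[OF i] P.mzero_closed
    by (auto simp: P_mult_eq_iff atom_apply coatom_apply mzero_P)
qed

text \<open>At coordinate \<open>i\<close> the equation reads 0 = 0, and at every other
  \<open>k\<close> it reads \<open>x k\<close> = 1. The image of the embedding is thereby described
  by multiplication alone.\<close>

lemma mult_coatom_eq_iff:
  assumes i: "i \<in> I" and x: "x \<in> carrier P"
  shows "x \<otimes>\<^bsub>P\<^esub> coatom i = coatom i \<longleftrightarrow> x = prod_embed I M i (x i)"
proof -
  have "x \<otimes>\<^bsub>P\<^esub> coatom i = coatom i \<longleftrightarrow> (\<forall>k\<in>I. k \<noteq> i \<longrightarrow> x k = \<one>\<^bsub>M k\<^esub>)"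
    using x coatom_closed[OF i] component_closed[OF x]
    by (auto simp: P_mult_eq_iff coatom_apply)
  also have "\<dots> \<longleftrightarrow> x = prod_embed I M i (x i)"
    using P_ext[OF x prod_embed_closed[OF i component_closed[OF x i]]]
    by (metis prod_embed_apply)
  finally show ?thesis .
qed

text \<open>Away from \<open>i\<close> both products are 0, and at \<open>i\<close> the factor is 1.
  Equality of \<open>i\<close>-th coordinates thus becomes an equation in the product.\<close>

lemma mult_atom_eq_iff:
  assumes "i \<in> I" "x \<in> carrier P" "y \<in> carrier P"
  shows "x \<otimes>\<^bsub>P\<^esub> atom i = y \<otimes>\<^bsub>P\<^esub> atom i \<longleftrightarrow> x i = y i"
  using assms atom_closed[of i] P_closed_mult[of y "atom i"]
  by (auto simp: P_mult_eq_iff P_mult_apply atom_apply component_closed)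

end

section \<open>Isomorphisms between two such products\<close>

locale indecomposable_family_iso =
  M: indecomposable_family I M + N: indecomposable_family J N for I M J N +
  fixes \<Phi>
  assumes Phi_iso: "\<Phi> \<in> iso (product_group I M) (product_group J N)"
begin

sublocale Phi: monoid_with_zero_iso "product_group I M" "product_group J N" \<Phi>
  by unfold_locales (rule Phi_iso)

lemma Phi_coatom: "i \<in> I \<Longrightarrow> \<exists>j\<in>J. \<Phi> (M.coatom i) = N.coatom j"
  using Phi.CCE_coatom_iff[OF M.coatom_closed] M.CCE_coatom_P_iff N.CCE_coatom_P_iff by blast

text \<open>For \<open>i\<close> in \<open>I\<close> the chosen index is determined, since distinct
  indices of \<open>J\<close> have distinct coatoms.\<close>

definition \<sigma> where
  "\<sigma> i = (SOME j. j \<in> J \<and> \<Phi> (M.coatom i) = N.coatom j)"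

text \<open>Only coordinate \<open>\<sigma> i\<close> of the image is kept;
  \<open>Phi_prod_embed\<close> shows that the other coordinates are 1, so nothing is lost.\<close>

definition \<phi> where
  "\<phi> i x = \<Phi> (prod_embed I M i x) (\<sigma> i)"

lemma sigma: "i \<in> I \<Longrightarrow> \<sigma> i \<in> J" "i \<in> I \<Longrightarrow> \<Phi> (M.coatom i) = N.coatom (\<sigma> i)"
  unfolding \<sigma>_def using someI_ex[OF Phi_coatom[unfolded Bex_def]] by blast+

text \<open>Injectivity follows from that of \<open>\<Phi>\<close> and the distinctness of coatoms.
  For surjectivity, the preimage of a coatom under \<open>\<Phi>\<close> is again a coatom.\<close>

lemma sigma_bij: "bij_betw \<sigma> I J"
proof (rule bij_betw_imageI)
  show "inj_on \<sigma> I"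
    by (rule inj_onI) (metis sigma(2) Phi.eq_iff M.coatom_closed M.coatom_eq_iff)
  show "\<sigma> ` I = J"
  proof (intro equalityI subsetI)
    fix j assume j: "j \<in> J"
    obtain c where c: "c \<in> carrier M.P" "N.coatom j = \<Phi> c"
      using Phi.surjE N.coatom_closed[OF j] by blast
    then have "CCE_coatom M.P c" using j Phi.CCE_coatom_iff N.CCE_coatom_P_iff by metis
    then obtain i where i: "i \<in> I" "c = M.coatom i" using M.CCE_coatom_P_iff by blast
    then have "j = \<sigma> i" using c sigma N.coatom_eq_iff[OF j] by metis
    then show "j \<in> \<sigma> ` I" using i by blast
  qed (auto simp: sigma)
qed

text \<open>\<open>atom_iff\<close> singles out an atom by \<open>CCE\<close>, the zero and its
  product with the coatom, all of which \<open>\<Phi>\<close> respects.\<close>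

lemma Phi_atom:
  assumes i: "i \<in> I"
  shows "\<Phi> (M.atom i) = N.atom (\<sigma> i)"
proof -
  have "M.atom i \<in> CCE M.P" "M.atom i \<noteq> mzero M.P" "M.coatom i \<otimes>\<^bsub>M.P\<^esub> M.atom i = mzero M.P"
    using M.atom_iff[OF i, of "M.atom i"] by blast+
  then show ?thesis
    unfolding N.atom_iff[OF sigma(1)[OF i]]
    using sigma(2)[OF i] M.atom_closed M.coatom_closed[OF i] M.P.mzero_closed
      Phi.CCE_iff Phi.eq_iff Phi.mult Phi.map_mzero by metis
qed

text \<open>By \<open>mult_coatom_eq_iff\<close> both sides are fixing equations for a coatom, and
  \<open>\<Phi>\<close> carries the first equation to the second. The backward direction is what
  later makes \<open>\<phi> i\<close> surjective.\<close>

lemma image_embed_iff: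
  assumes i: "i \<in> I" and x: "x \<in> carrier M.P"
  shows "x = prod_embed I M i (x i) \<longleftrightarrow> \<Phi> x = prod_embed J N (\<sigma> i) (\<Phi> x (\<sigma> i))"
  using Phi.mult_eq_iff[OF x M.coatom_closed[OF i] M.coatom_closed[OF i]]
    M.mult_coatom_eq_iff[OF i x] N.mult_coatom_eq_iff[OF sigma(1)[OF i] Phi.closed[OF x]]
    sigma(2)[OF i] by simp

lemma Phi_prod_embed:
  assumes i: "i \<in> I" and x: "x \<in> carrier (M i)"
  shows "\<Phi> (prod_embed I M i x) = prod_embed J N (\<sigma> i) (\<phi> i x)"
  using image_embed_iff[OF i M.prod_embed_closed[OF i x]] i
  by (simp add: M.prod_embed_apply \<phi>_def)

lemma phi_closed: "i \<in> I \<Longrightarrow> x \<in> carrier (M i) \<Longrightarrow> \<phi> i x \<in> carrier (N (\<sigma> i))"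
  unfolding \<phi>_def using N.component_closed Phi.closed M.prod_embed_closed sigma(1) by blast

lemma phi_iso:
  assumes i: "i \<in> I"
  shows "\<phi> i \<in> iso (M i) (N (\<sigma> i))"
  unfolding iso_iff
proof (intro conjI)
  note j = sigma(1)[OF i]
  show "\<phi> i \<in> hom (M i) (N (\<sigma> i))"
  proof (rule homI)
    fix x y assume xy: "x \<in> carrier (M i)" "y \<in> carrier (M i)"
    then have "\<Phi> (prod_embed I M i (x \<otimes>\<^bsub>M i\<^esub> y))
        = \<Phi> (prod_embed I M i x) \<otimes>\<^bsub>N.P\<^esub> \<Phi> (prod_embed I M i y)"
      using i by (metis M.prod_embed_mult M.prod_embed_closed Phi.mult)
    then show "\<phi> i (x \<otimes>\<^bsub>M i\<^esub> y) = \<phi> i x \<otimes>\<^bsub>N (\<sigma> i)\<^esub> \<phi> i y"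
      unfolding \<phi>_def using N.P_mult_apply[OF j] by simp
  qed (rule phi_closed[OF i])
  show "inj_on (\<phi> i) (carrier (M i))"
  proof (rule inj_onI)
    fix x y assume xy: "x \<in> carrier (M i)" "y \<in> carrier (M i)" "\<phi> i x = \<phi> i y"
    \<comment> \<open>By \<open>Phi_prod_embed\<close> the whole image tuple is determined by its
      coordinate \<open>\<sigma> i\<close>.\<close>
    then have "\<Phi> (prod_embed I M i x) = \<Phi> (prod_embed I M i y)"
      using i by (simp add: Phi_prod_embed)
    then show "x = y"
      using xy i by (metis Phi.eq_iff M.prod_embed_closed M.prod_embed_inj)
  qed
  show "\<phi> i ` carrier (M i) = carrier (N (\<sigma> i))"
  proof (intro equalityI subsetI)
    fix y assume y: "y \<in> carrier (N (\<sigma> i))"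
    obtain x where x: "x \<in> carrier M.P" "prod_embed J N (\<sigma> i) y = \<Phi> x"
      using Phi.surjE N.prod_embed_closed[OF j y] by blast
    moreover have "\<Phi> x (\<sigma> i) = y"
      using x(2) N.prod_embed_apply[OF j] by metis
    \<comment> \<open>The preimage of an embedded element is itself embedded, so its coordinate
      \<open>x i\<close> is the required preimage of \<open>y\<close>.\<close>
    ultimately have "x = prod_embed I M i (x i)" using image_embed_iff[OF i x(1)] by simp
    then have "\<phi> i (x i) = y" using \<open>\<Phi> x (\<sigma> i) = y\<close> unfolding \<phi>_def by simp
    then show "y \<in> \<phi> i ` carrier (M i)" using M.component_closed[OF x(1) i] by blast
  qed (use phi_closed[OF i] in blast)
qed

text \<open>The tuple \<open>f\<close> is compared with the embedding of \<open>f i\<close>. They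
  agree at \<open>i\<close>, hence after multiplication by \<open>M.atom i\<close>; applying
  \<open>\<Phi>\<close> turns this into agreement of their images at
  \<open>\<sigma> i\<close>.\<close>

lemma Phi_proj:
  assumes i: "i \<in> I" and f: "f \<in> carrier M.P"
  shows "\<Phi> f (\<sigma> i) = \<phi> i (f i)"
proof -
  note e = M.prod_embed_closed[OF i M.component_closed[OF f i]]
  have "f \<otimes>\<^bsub>M.P\<^esub> M.atom i = prod_embed I M i (f i) \<otimes>\<^bsub>M.P\<^esub> M.atom i"
    unfolding M.mult_atom_eq_iff[OF i f e] using i by (simp add: M.prod_embed_apply)
  then have "\<Phi> f \<otimes>\<^bsub>N.P\<^esub> N.atom (\<sigma> i) = \<Phi> (prod_embed I M i (f i)) \<otimes>\<^bsub>N.P\<^esub> N.atom (\<sigma> i)"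
    using Phi.mult f e M.atom_closed Phi_atom[OF i] by metis
  then show ?thesis
    unfolding N.mult_atom_eq_iff[OF sigma(1)[OF i] Phi.closed[OF f] Phi.closed[OF e]] \<phi>_def .
qed

lemma monomial_via: "monomial_via I M J N \<Phi> \<sigma> \<phi>"
  unfolding monomial_via_def prod_proj_def
  using sigma_bij phi_iso Phi_prod_embed Phi_proj by blast

lemma monomial_via_unique:
  assumes "monomial_via I M J N \<Phi> \<sigma>' \<phi>'" and i: "i \<in> I"
  shows "\<sigma>' i = \<sigma> i" and "x \<in> carrier (M i) \<Longrightarrow> \<phi>' i x = \<phi> i x"
proof -
  have j': "\<sigma>' i \<in> J" and emb: "\<And>x. x \<in> carrier (M i) \<Longrightarrow>
      \<Phi> (prod_embed I M i x) = prod_embed J N (\<sigma>' i) (\<phi>' i x)"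
    using assms unfolding monomial_via_def by (auto dest: bij_betwE)
  \<comment> \<open>Evaluating the embedding condition at 0 determines the index: the left side is 0
    at \<open>\<sigma> i\<close>, whereas the right side would be 1 there if
    \<open>\<sigma>' i\<close> were different.\<close>
  have "N.coatom (\<sigma> i) = prod_embed J N (\<sigma>' i) (\<phi>' i (mzero (M i)))"
    using emb[of "mzero (M i)"] sigma(2)[OF i] i by (simp add: M.coatom_def)
  from fun_cong[OF this, of "\<sigma> i"] show eq: "\<sigma>' i = \<sigma> i"
    using sigma(1)[OF i] by (auto simp: N.coatom_apply N.prod_embed_apply split: if_splits)
  \<comment> \<open>With the indices equal, both values are coordinate \<open>\<sigma> i\<close> of
    the same tuple.\<close>
  show "\<phi>' i x = \<phi> i x" if "x \<in> carrier (M i)"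
    using emb[OF that] sigma(1)[OF i] by (simp add: \<phi>_def eq N.prod_embed_apply)
qed

end

theorem theorem3p3:
  fixes I :: "'i set" and J :: "'j set"
    and M :: "'i \<Rightarrow> ('a, 'm) monoid_scheme" and N :: "'j \<Rightarrow> ('b, 'n) monoid_scheme"
    and \<Phi> :: "('i \<Rightarrow> 'a) \<Rightarrow> ('j \<Rightarrow> 'b)"
  assumes "\<And>i. i \<in> I \<Longrightarrow> monoid_with_zero (M i)"
    and "\<And>i. i \<in> I \<Longrightarrow> nontrivial_monoid (M i)"
    and "\<And>i. i \<in> I \<Longrightarrow> CCE (M i) = {mzero (M i), \<one>\<^bsub>M i\<^esub>}"
    and "\<And>j. j \<in> J \<Longrightarrow> monoid_with_zero (N j)"
    and "\<And>j. j \<in> J \<Longrightarrow> nontrivial_monoid (N j)"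
    and "\<And>j. j \<in> J \<Longrightarrow> CCE (N j) = {mzero (N j), \<one>\<^bsub>N j\<^esub>}"
    and "\<Phi> \<in> iso (product_group I M) (product_group J N)"
  shows "monomial I M J N \<Phi> \<and>
    (\<exists>\<sigma> \<phi>. monomial_via I M J N \<Phi> \<sigma> \<phi> \<and>
       (\<forall>\<sigma>' \<phi>'. monomial_via I M J N \<Phi> \<sigma>' \<phi>' \<longrightarrow>
          (\<forall>i\<in>I. \<sigma>' i = \<sigma> i \<and> (\<forall>x\<in>carrier (M i). \<phi>' i x = \<phi> i x))))"
proof -
  interpret indecomposable_family_iso I M J N \<Phi>
    by (simp add: assms indecomposable_family_iso_def indecomposable_family_def
        indecomposable_family_iso_axioms_def)
  show ?thesis
    unfolding monomial_def using monomial_via monomial_via_unique by blast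
qed

end
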